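(* For all integers $n,k\ge 0$, $$|s^{-1}(\mathfrak{S}_{n,k})| = k!\cdot C_n^{(k)},$$ where $s:\mathfrak{S}_{n+k}\to\mathfrak{S}_{n+k}$ is the stack-sorting map, $\mathfrak{S}_{n,k}=\{w\in\mathfrak{S}_{n+k} : w_i=i\text{ for all } i>k\}$, and $C_n^{(k)}$ is the $k$th Catalan convolution.
   Context: $\mathfrak{S}_m$ is the set of permutations of $\{1,\ldots,m\}$ in one-line notation. The stack-sorting map $s:\mathfrak{S}_m\to\mathfrak{S}_m$ processes the entries of $\pi$ from left to right using an initially empty stack: for each next entry $x$, while the stack is nonempty and its top is smaller than $x$, pop the top to the end of the output; then push $x$. After all entries have been read, pop all remaining stack entries to the output. The output word is $s(\pi)$. Equivalently, $s$ of the empty word is empty and $s(LmR)=s(L)s(R)m$, where $m$ is the largest entry. The Catalan numbers are $C_a=\frac{1}{a+1}\binom{2a}{a}$. For $n,k\in\mathbb{Z}_{\ge0}$ the $k$th Catalan convolution is $$C_n^{(k)}=\sum_{\substack{a_1+\cdots+a_{k+1}=n\\ a_1,\ldots,a_{k+1}\in\mathbb{Z}_{\ge0}}}C_{a_1}C_{a_2}\cdots C_{a_{k+1}}.$$ *)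

theory Defs
  imports Complex_Main "HOL-Combinatorics.Multiset_Permutations"
begin

text \<open>The first argument is the current stack, its top being the head of the list; the second
  is the remaining input; the result is the output still to be produced.\<close>

primrec stack_run :: "nat list \<Rightarrow> nat list \<Rightarrow> nat list" where
  "stack_run st [] = st"
| "stack_run st (x # xs) =
     takeWhile (\<lambda>t. t < x) st @ stack_run (x # dropWhile (\<lambda>t. t < x) st) xs"

definition stack_sort :: "nat list \<Rightarrow> nat list" where
  "stack_sort xs = stack_run [] xs"

text \<open>Permutations in one-line notation, as lists.\<close>

definition perms :: "nat \<Rightarrow> nat list set" where
  "perms m = permutations_of_set {1..m}"

text \<open>The entry \<open>w\<^sub>i\<close> is \<open>w ! (i - 1)\<close>, since list positions start at 0.\<close>

definition perms_fix_above :: "nat \<Rightarrow> nat \<Rightarrow> nat list set" where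
  "perms_fix_above n k = {w \<in> perms (n + k). \<forall>i. k < i \<and> i \<le> n + k \<longrightarrow> w ! (i - 1) = i}"

text \<open>The division is exact, see \<open>real_catalan\<close>.\<close>

definition catalan :: "nat \<Rightarrow> nat" where
  "catalan a = ((2 * a) choose a) div (a + 1)"

definition catalan_conv :: "nat \<Rightarrow> nat \<Rightarrow> nat" where
  "catalan_conv n k = (\<Sum>as | length as = k + 1 \<and> sum_list as = n. prod_list (map catalan as))"

lemma real_catalan: "real (catalan a) = 1 / (real a + 1) * real ((2 * a) choose a)"
proof -
  define b c where "b = (2 * a) choose a" and "c = (2 * a) choose Suc a"
  have "Suc a * c = a * b"
    using binomial_absorb_comp[of "2 * a" a] binomial_absorption[of a "2 * a"]
    unfolding b_def c_def by (simp only: mult_2 add_diff_cancel_left')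
  then have "Suc a * (b - c) = b"
    by (simp only: diff_mult_distrib2) simp
  then have "Suc a dvd ((2 * a) choose a)"
    unfolding b_def by (metis dvd_triv_left)
  then show ?thesis
    by (simp add: catalan_def real_of_nat_div add.commute)
qed

lemma finite_weak_compositions: "finite {as :: nat list. length as = m \<and> sum_list as = n}"
proof (rule finite_subset)
  show "{as. length as = m \<and> sum_list as = n} \<subseteq> {as. set as \<subseteq> {..n} \<and> length as = m}"
    by (auto simp: member_le_sum_list)
  show "finite {as. set as \<subseteq> {..n} \<and> length as = m}"
    by (rule finite_lists_length_eq) simp
qed

lemma mset_stack_run: "mset (stack_run st xs) = mset st + mset xs"
proof (induction xs arbitrary: st)
  case (Cons x xs)
  have "mset (takeWhile (\<lambda>t. t < x) st) + mset (dropWhile (\<lambda>t. t < x) st) = mset st"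
    by (metis mset_append takeWhile_dropWhile_id)
  with Cons show ?case
    by (simp add: ac_simps)
qed simp

lemma stack_sort_in_perms: "w \<in> perms m \<Longrightarrow> stack_sort w \<in> perms m"
  using mset_stack_run[of "[]" w] mset_eq_setD[of "stack_sort w" w]
    mset_eq_imp_distinct_iff[of "stack_sort w" w]
  by (simp add: perms_def permutations_of_set_def stack_sort_def)

lemma stack_sort_Nil: "stack_sort [] = []"
  by (simp add: stack_sort_def)

lemma stack_run_bottom:
  "\<forall>x\<in>set xs. x \<le> m \<Longrightarrow> stack_run (st @ [m]) xs = stack_run st xs @ [m]"
proof (induction xs arbitrary: st)
  case (Cons x xs)
  then have "\<not> m < x" by simp
  then have "takeWhile (\<lambda>t. t < x) (st @ [m]) = takeWhile (\<lambda>t. t < x) st"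
    and "dropWhile (\<lambda>t. t < x) (st @ [m]) = dropWhile (\<lambda>t. t < x) st @ [m]"
    by (induction st) auto
  with Cons.IH[of "x # dropWhile (\<lambda>t. t < x) st"] Cons.prems show ?case
    by simp
qed simp

lemma stack_run_append_max:
  "\<forall>x\<in>set st \<union> set xs. x < m \<Longrightarrow> stack_run st (xs @ m # ys) = stack_run st xs @ stack_run [m] ys"
proof (induction xs arbitrary: st)
  case Nil
  then have "takeWhile (\<lambda>t. t < m) st = st" "dropWhile (\<lambda>t. t < m) st = []"
    by auto
  then show ?case by (simp only: append_Nil stack_run.simps)
next
  case (Cons x xs)
  have "\<forall>y\<in>set (x # dropWhile (\<lambda>t. t < x) st) \<union> set xs. y < m"
    using Cons.prems by (auto dest: set_dropWhileD)
  from Cons.IH[OF this] show ?case by simp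
qed

lemma stack_sort_rec:
  assumes "\<forall>x\<in>set L \<union> set R. x < m"
  shows "stack_sort (L @ m # R) = stack_sort L @ stack_sort R @ [m]"
  using stack_run_append_max[of "[]" L m R] stack_run_bottom[of R m "[]"] assms
  by (simp add: stack_sort_def less_imp_le)

end

theory Submission
  imports Defs "HOL-Computational_Algebra.Formal_Power_Series"
begin

text \<open>The proof builds the permutations to be counted from those of \<open>{1..k}\<close> by inserting
  the entries above \<open>k\<close> in increasing order, and recognizes the insertion process as the
  generating tree of the Catalan numbers.

  A permutation \<open>v\<close> of \<open>{1..n + k}\<close> fixes every \<open>i > k\<close> exactly if each entry above \<open>k\<close> is smaller
  than everything to its right (\<open>fixes_above_iff_ascends_above\<close>). Call \<open>w\<close> sorting if \<open>stack_sort w\<close>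
  has this property. From \<open>stack_sort (L m R) = stack_sort L \<cdot> stack_sort R \<cdot> m\<close> it follows that putting
  a new maximum \<open>m\<close> between \<open>L\<close> and \<open>R\<close> gives a sorting word if and only if \<open>L R\<close> is sorting and no
  entry of \<open>L\<close> above \<open>k\<close> exceeds an entry of \<open>R\<close> (\<open>sorts_above_insert_max\<close>). Such a gap is called an
  active site of \<open>L R\<close>.

  Suppose that \<open>w\<close> has \<open>r\<close> active sites and that \<open>m\<close> goes to the \<open>j\<close>-th of them from the left. Of the
  gaps to the right of \<open>m\<close>, only the one at the end is active, because \<open>m\<close> exceeds whatever follows;
  the gaps to its left keep their status. So \<open>j + 1\<close> active sites result
  (\<open>card_active_sites_insert_at\<close>). Hence the sorting permutations form a forest in which a node
  with label \<open>r\<close> has children with labels \<open>2, \<dots>, r + 1\<close>. Its roots are the \<open>k!\<close> permutations of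
  \<open>{1..k}\<close>, where every one of the \<open>k + 1\<close> gaps is active.

  Let \<open>F\<^sub>r\<close> be the generating function of the level sizes below a node with label \<open>r\<close>. The rule for
  the children gives \<open>F\<^sub>0 = 1\<close> and \<open>F\<^sub>r\<^sub>+\<^sub>1 = F\<^sub>r + x F\<^sub>r\<^sub>+\<^sub>2\<close>. This recurrence forces
  \<open>F\<^sub>a\<^sub>+\<^sub>b = F\<^sub>a F\<^sub>b\<close> (\<open>tree_fps_add\<close>), so that \<open>F\<^sub>k\<^sub>+\<^sub>1\<close> is the \<open>(k + 1)\<close>-st power of \<open>F\<^sub>1\<close>, and it is solved by
  ballot numbers (\<open>tree_level_ballot\<close>), which identify \<open>F\<^sub>1\<close> as the Catalan series
  (\<open>tree_level_1\<close>).\<close>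

section \<open>The condition on the sorted word\<close>

definition ascends_above :: "nat \<Rightarrow> nat list \<Rightarrow> bool" where
  "ascends_above k = sorted_wrt (\<lambda>b a. k < b \<longrightarrow> b < a)"

definition separated :: "nat \<Rightarrow> nat list \<Rightarrow> nat list \<Rightarrow> bool" where
  "separated k L R \<longleftrightarrow> (\<forall>b\<in>set L. \<forall>a\<in>set R. k < b \<longrightarrow> b < a)"

lemma separated_simps [simp]:
  "separated k [] R" "separated k L []"
  "separated k (L @ L') R \<longleftrightarrow> separated k L R \<and> separated k L' R"
  "separated k L (R @ R') \<longleftrightarrow> separated k L R \<and> separated k L R'"
  by (auto simp: separated_def)

lemma ascends_above_append:
  "ascends_above k (u @ v) \<longleftrightarrow> ascends_above k u \<and> ascends_above k v \<and> separated k u v"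
  by (auto simp: ascends_above_def separated_def sorted_wrt_append)

lemma ascends_above_singleton [simp]: "ascends_above k [x]"
  by (simp add: ascends_above_def)

lemma perms_iff: "w \<in> perms m \<longleftrightarrow> set w = {1..m} \<and> distinct w"
  by (simp add: perms_def permutations_of_set_def)

lemma length_perms: "w \<in> perms m \<Longrightarrow> length w = m"
  using distinct_card[of w] by (auto simp: perms_iff)

lemma snoc_in_perms: "u @ [Suc m] \<in> perms (Suc m) \<longleftrightarrow> u \<in> perms m"
proof -
  have interval: "{1..Suc m} = insert (Suc m) {1..m}"
    by (auto simp: atLeastAtMostSuc_conv)
  have notin: "Suc m \<notin> {1..m}"
    by simp
  have "insert (Suc m) (set u) = insert (Suc m) {1..m} \<longleftrightarrow> set u = {1..m}" if "Suc m \<notin> set u"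
    using that notin by (rule insert_ident)
  then show ?thesis
    unfolding perms_iff interval using notin
    by (cases "Suc m \<in> set u") (simp_all del: atLeastAtMost_iff, metis notin)
qed

lemma ascends_above_low:
  assumes "\<forall>x\<in>set v. x \<le> k"
  shows "ascends_above k v"
proof -
  have "sorted_wrt (\<lambda>_ _. True) v"
    by (induction v) auto
  then show ?thesis
    unfolding ascends_above_def by (rule sorted_wrt_mono_rel[rotated]) (use assms in auto)
qed

text \<open>By induction on \<open>n\<close>: under either condition the largest entry must come last, and removing it
  leaves the same question for \<open>n - 1\<close>.\<close>

lemma fixes_above_iff_ascends_above:
  assumes "v \<in> perms (n + k)"
  shows "v \<in> perms_fix_above n k \<longleftrightarrow> ascends_above k v"
  using assms
proof (induction n arbitrary: v)
  case 0
  then have "ascends_above k v"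
    by (intro ascends_above_low) (simp add: perms_iff)
  with 0 show ?case
    by (auto simp: perms_fix_above_def)
next
  case (Suc n)
  let ?m = "Suc (n + k)"
  have len: "length v = ?m"
    using length_perms[OF Suc.prems] by simp
  then obtain u y where v: "v = u @ [y]"
    by (cases v rule: rev_cases) auto
  have lu: "length u = n + k"
    using len v by simp
  show ?case
  proof (cases "y = ?m")
    case True
    have u: "u \<in> perms (n + k)"
      using Suc.prems unfolding v True by (simp add: snoc_in_perms)
    have "v \<in> perms_fix_above (Suc n) k \<longleftrightarrow> u \<in> perms_fix_above n k"
      using Suc.prems u lu unfolding perms_fix_above_def v True
      by (auto simp: nth_append le_Suc_eq)
    moreover have "separated k u [y]"
      using u by (auto simp: separated_def perms_iff True)
    then have "ascends_above k v \<longleftrightarrow> ascends_above k u"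
      by (simp add: v ascends_above_append)
    ultimately show ?thesis
      using Suc.IH[OF u] by simp
  next
    case False
    have "v ! (?m - 1) = y"
      using lu by (simp add: v nth_append)
    moreover have "v ! (?m - 1) = ?m" if "v \<in> perms_fix_above (Suc n) k"
    proof -
      have "\<forall>i. k < i \<and> i \<le> Suc n + k \<longrightarrow> v ! (i - 1) = i"
        using that unfolding perms_fix_above_def by blast
      then show ?thesis
        by (metis add_Suc le_add2 le_refl less_Suc_eq_le)
    qed
    ultimately have "v \<notin> perms_fix_above (Suc n) k"
      using False by auto
    moreover have "?m \<in> set u" "y \<le> ?m"
      using Suc.prems False by (auto simp: perms_iff v)
    then have "\<not> separated k u [y]"
      unfolding separated_def by force
    ultimately show ?thesis
      by (simp add: v ascends_above_append)
  qed
qed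

section \<open>Inserting a new maximum\<close>

definition sorts_above :: "nat \<Rightarrow> nat list \<Rightarrow> bool" where
  "sorts_above k w \<longleftrightarrow> ascends_above k (stack_sort w)"

lemma set_stack_sort: "set (stack_sort w) = set w"
  using mset_stack_run[of "[]" w] by (metis add_0 mset.simps(1) set_mset_mset stack_sort_def)

lemma sorts_above_split_max:
  assumes "\<forall>x\<in>set L \<union> set R. x < m"
  shows "sorts_above k (L @ m # R) \<longleftrightarrow> sorts_above k L \<and> sorts_above k R \<and> separated k L R"
proof -
  have "stack_sort (L @ m # R) = stack_sort L @ stack_sort R @ [m]"
    using assms by (rule stack_sort_rec)
  moreover have "separated k (stack_sort L) [m]" "separated k (stack_sort R) [m]"
    using assms by (auto simp: separated_def set_stack_sort)
  moreover have "separated k (stack_sort L) (stack_sort R) \<longleftrightarrow> separated k L R"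
    by (simp add: separated_def set_stack_sort)
  ultimately show ?thesis
    by (auto simp: sorts_above_def ascends_above_append)
qed

text \<open>Deleting the maximum joins the words on its two sides, and the stack then mixes them. If they
  are separated this does no harm: splitting at the maximum of \<open>L @ R\<close>, which lies in \<open>L\<close> or in \<open>R\<close>,
  leaves a shorter pair of separated words still joined, to which the induction hypothesis
  applies.\<close>

lemma sorts_above_append:
  assumes "distinct (L @ R)" "separated k L R"
  shows "sorts_above k (L @ R) \<longleftrightarrow> sorts_above k L \<and> sorts_above k R"
  using assms
proof (induction "length (L @ R)" arbitrary: L R rule: less_induct)
  case less
  show ?case
  proof (cases "L @ R = []")
    case True
    then show ?thesis
      by (simp add: sorts_above_def stack_sort_Nil ascends_above_def)
  next
    case False
    define m where "m = Max (set (L @ R))"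
    have "m \<in> set (L @ R)"
      unfolding m_def using False by (intro Max_in) auto
    have le: "x \<le> m" if "x \<in> set (L @ R)" for x
      unfolding m_def using that by (intro Max_ge) auto
    from \<open>m \<in> set (L @ R)\<close> consider "m \<in> set L" | "m \<in> set R"
      by auto
    then show ?thesis
    proof cases
      case 1
      then obtain L1 L2 where L: "L = L1 @ m # L2"
        by (auto dest: split_list)
      have lt: "\<forall>x\<in>set L1 \<union> set (L2 @ R). x < m"
      proof
        fix x assume x: "x \<in> set L1 \<union> set (L2 @ R)"
        then have "x \<le> m" using le by (auto simp: L)
        moreover have "x \<noteq> m" using x less.prems(1) by (auto simp: L)
        ultimately show "x < m" by simp
      qed
      then have lt': "\<forall>x\<in>set L1 \<union> set L2. x < m"
        by auto
      have sep: "separated k L1 R" "separated k L2 R"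
        using less.prems(2) by (auto simp: separated_def L)
      have IH: "sorts_above k (L2 @ R) \<longleftrightarrow> sorts_above k L2 \<and> sorts_above k R"
        by (rule less.hyps) (use less.prems sep in \<open>auto simp: L\<close>)
      show ?thesis
        using sorts_above_split_max[OF lt, of k] sorts_above_split_max[OF lt', of k] IH sep
        by (simp add: L) blast
    next
      case 2
      then obtain R1 R2 where R: "R = R1 @ m # R2"
        by (auto dest: split_list)
      have lt: "\<forall>x\<in>set (L @ R1) \<union> set R2. x < m"
      proof
        fix x assume x: "x \<in> set (L @ R1) \<union> set R2"
        then have "x \<le> m" using le by (auto simp: R)
        moreover have "x \<noteq> m" using x less.prems(1) by (auto simp: R)
        ultimately show "x < m" by simp
      qed
      then have lt': "\<forall>x\<in>set R1 \<union> set R2. x < m"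
        by auto
      have sep: "separated k L R1" "separated k L R2"
        using less.prems(2) by (auto simp: separated_def R)
      have IH: "sorts_above k (L @ R1) \<longleftrightarrow> sorts_above k L \<and> sorts_above k R1"
        by (rule less.hyps) (use less.prems sep in \<open>auto simp: R\<close>)
      show ?thesis
        using sorts_above_split_max[OF lt, of k] sorts_above_split_max[OF lt', of k] IH sep
        by (simp add: R)
    qed
  qed
qed

lemma sorts_above_insert_max:
  assumes "distinct (L @ R)" "\<forall>x\<in>set L \<union> set R. x < m"
  shows "sorts_above k (L @ m # R) \<longleftrightarrow> sorts_above k (L @ R) \<and> separated k L R"
  using sorts_above_split_max[OF assms(2), of k] sorts_above_append[OF assms(1), of k] by blast

definition insert_at :: "nat \<Rightarrow> nat \<Rightarrow> nat list \<Rightarrow> nat list" where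
  "insert_at i m w = take i w @ m # drop i w"

text \<open>A site is the number of entries to its left.\<close>

definition active_sites :: "nat \<Rightarrow> nat list \<Rightarrow> nat set" where
  "active_sites k w = {i. i \<le> length w \<and> separated k (take i w) (drop i w)}"

lemma finite_active_sites [simp]: "finite (active_sites k w)"
  by (rule finite_subset[of _ "{..length w}"]) (auto simp: active_sites_def)

text \<open>To the left of the new maximum \<open>m\<close> nothing changes, since \<open>m\<close> joins the right-hand part, where
  larger entries are harmless. To its right \<open>m\<close> belongs to the left-hand part and exceeds every entry
  to come, so only the site at the very end is active. The gap just before \<open>m\<close> is site \<open>i\<close>.\<close>

lemma active_sites_insert_at:
  assumes "\<forall>x\<in>set w. x < m" "k < m" "i \<le> length w"
  shows "active_sites k (insert_at i m w)
       = insert (Suc (length w)) {j \<in> active_sites k w. j \<le> i}"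
proof (intro set_eqI)
  fix j
  let ?w = "insert_at i m w"
  have len: "length ?w = Suc (length w)"
    using assms(3) by (simp add: insert_at_def)
  consider "j \<le> i" | "i < j" "j \<le> length w" | "length w < j"
    by linarith
  then show "j \<in> active_sites k ?w \<longleftrightarrow> j \<in> insert (Suc (length w)) {j \<in> active_sites k w. j \<le> i}"
  proof cases
    case 1
    have "drop j w = drop j (take i w) @ drop i w"
      using 1 assms(3) by (metis append_take_drop_id diff_is_0_eq' drop_0 drop_append length_take min.absorb2)
    moreover have "drop j ?w = drop j (take i w) @ m # drop i w" "take j ?w = take j w"
      using 1 assms(3) by (simp_all add: insert_at_def min_def)
    moreover have "\<forall>b\<in>set (take j w). b < m"
      using assms(1) by (auto dest: in_set_takeD)
    ultimately have "separated k (take j ?w) (drop j ?w) \<longleftrightarrow> separated k (take j w) (drop j w)"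
      by (auto simp: separated_def)
    with 1 assms(3) len show ?thesis
      by (auto simp: active_sites_def)
  next
    case 2
    \<comment> \<open>The pair formed by \<open>m\<close> and the last entry of \<open>w\<close> violates separation.\<close>
    have "m \<in> set (take j ?w)"
      using 2 by (auto simp: insert_at_def take_Cons' min_def)
    moreover have "last w \<in> set (drop j ?w)" "last w \<in> set w"
    proof -
      have "drop j ?w = drop (j - 1) w"
        using 2 by (simp add: insert_at_def drop_Cons')
      with 2 show "last w \<in> set (drop j ?w)"
        by (metis One_nat_def Suc_diff_1 Suc_le_eq drop_eq_Nil gr_implies_not0 last_drop last_in_set
            leD not_gr_zero)
      then show "last w \<in> set w"
        using \<open>drop j ?w = drop (j - 1) w\<close> by (auto dest: in_set_dropD)
    qed
    ultimately have "\<not> separated k (take j ?w) (drop j ?w)"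
      using assms(1,2) by (auto simp: separated_def dest: less_asym)
    with 2 show ?thesis
      by (auto simp: active_sites_def)
  next
    case 3
    with assms(3) len show ?thesis
      by (auto simp: active_sites_def)
  qed
qed

lemma card_active_sites_insert_at:
  assumes "\<forall>x\<in>set w. x < m" "k < m" "i \<le> length w"
  shows "card (active_sites k (insert_at i m w)) = Suc (card {j \<in> active_sites k w. j \<le> i})"
  using assms(3) by (simp add: active_sites_insert_at[OF assms])

section \<open>The generating tree\<close>

text \<open>The number of nodes \<open>t\<close> levels below a node with label \<open>r\<close>, when such a node has one child for
  each of the labels \<open>2, \<dots>, r + 1\<close>.\<close>

primrec tree_level :: "nat \<Rightarrow> nat \<Rightarrow> nat" where
  "tree_level 0 r = 1"
| "tree_level (Suc t) r = (\<Sum>j<r. tree_level t (j + 2))"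

definition sorting_perms :: "nat \<Rightarrow> nat \<Rightarrow> nat list set" where
  "sorting_perms n k = {w \<in> perms (n + k). sorts_above k w}"

lemma finite_sorting_perms [simp]: "finite (sorting_perms n k)"
  by (simp add: sorting_perms_def perms_def)

text \<open>The number of \<open>j \<in> A\<close> with \<open>j \<le> i\<close> is the rank of \<open>i\<close> in \<open>A\<close>, and the ranks run through
  \<open>1, \<dots>, card A\<close>.\<close>

lemma sum_over_ranks:
  fixes f :: "nat \<Rightarrow> nat" and A :: "nat set"
  assumes "finite A"
  shows "(\<Sum>i\<in>A. f (card {j \<in> A. j \<le> i})) = (\<Sum>j<card A. f (Suc j))"
  using assms
proof (induction A rule: finite_linorder_max_induct)
  case empty
  then show ?case by simp
next
  case (insert b A)
  then have b: "b \<notin> A" by auto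
  have "{j \<in> insert b A. j \<le> i} = {j \<in> A. j \<le> i}" if "i \<in> A" for i
    using insert.hyps that by auto
  then have "(\<Sum>i\<in>A. f (card {j \<in> insert b A. j \<le> i})) = (\<Sum>j<card A. f (Suc j))"
    using insert.IH by simp
  moreover have "{j \<in> insert b A. j \<le> b} = insert b A"
    using insert.hyps by auto
  ultimately show ?case
    using insert.hyps b by simp
qed

lemma insert_max_bij:
  "bij_betw (\<lambda>(w, i). insert_at i (Suc (n + k)) w)
     (SIGMA w:sorting_perms n k. active_sites k w) (sorting_perms (Suc n) k)"
proof -
  let ?m = "Suc (n + k)"
  let ?P = "SIGMA w:sorting_perms n k. active_sites k w"
  let ?ins = "\<lambda>(w, i). insert_at i ?m w"
  have nm: "?m \<notin> set w" "\<forall>x\<in>set w. x < ?m" if "w \<in> perms (n + k)" for w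
    using that by (auto simp: perms_iff)
  have "inj_on ?ins ?P"
  proof (intro inj_onI, clarsimp)
    fix w i w' i'
    assume *: "w \<in> sorting_perms n k" "i \<in> active_sites k w"
      "w' \<in> sorting_perms n k" "i' \<in> active_sites k w'"
      "insert_at i ?m w = insert_at i' ?m w'"
    have "?m \<notin> set w" "?m \<notin> set w'"
      using * nm by (auto simp: sorting_perms_def)
    then have "?m \<notin> set (take i w)" "?m \<notin> set (take i' w')"
      by (auto dest: in_set_takeD)
    with *(5) have eq: "take i w = take i' w'" "drop i w = drop i' w'"
      using append_Cons_eq_iff[of ?m "take i w" "drop i w" "take i' w'" "drop i' w'"]
        \<open>?m \<notin> set w\<close> in_set_dropD[of ?m i w] unfolding insert_at_def by blast+
    then have "w = w'"
      by (metis append_take_drop_id)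
    moreover have "i = i'"
      using arg_cong[OF eq(1), of length] *(2,4) by (auto simp: active_sites_def)
    ultimately show "w = w' \<and> i = i'" by simp
  qed
  moreover have "?ins ` ?P = sorting_perms (Suc n) k"
  proof (intro equalityI subsetI)
    fix v assume "v \<in> ?ins ` ?P"
    then obtain w i where w: "w \<in> sorting_perms n k" "i \<in> active_sites k w"
      and v: "v = take i w @ ?m # drop i w"
      by (auto simp: insert_at_def)
    have wp: "w \<in> perms (n + k)"
      using w by (simp add: sorting_perms_def)
    have "mset v = mset (w @ [?m])"
      using arg_cong[OF append_take_drop_id[of i w], of mset] unfolding v
      by (simp del: append_take_drop_id)
    then have "v \<in> perms ?m"
      using snoc_in_perms[of w "n + k"] wp unfolding perms_iff
      by (metis mset_eq_imp_distinct_iff mset_eq_setD)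
    moreover have "\<forall>x\<in>set (take i w) \<union> set (drop i w). x < ?m"
      using nm(2)[OF wp] by (auto dest: in_set_takeD in_set_dropD)
    then have "sorts_above k v"
      unfolding v using sorts_above_insert_max[of "take i w" "drop i w" ?m k] w
      by (simp add: sorting_perms_def active_sites_def perms_iff)
    ultimately show "v \<in> sorting_perms (Suc n) k"
      by (simp add: sorting_perms_def)
  next
    fix v assume "v \<in> sorting_perms (Suc n) k"
    then have vp: "v \<in> perms ?m" and sv: "sorts_above k v"
      by (auto simp: sorting_perms_def)
    then have "?m \<in> set v"
      by (auto simp: perms_iff)
    then obtain L R where v: "v = L @ ?m # R"
      by (auto dest: split_list)
    have "mset v = mset ((L @ R) @ [?m])"
      unfolding v by simp
    then have "(L @ R) @ [?m] \<in> perms ?m"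
      using vp unfolding perms_iff by (metis mset_eq_imp_distinct_iff mset_eq_setD)
    then have LR: "L @ R \<in> perms (n + k)"
      by (simp only: snoc_in_perms)
    then have "sorts_above k (L @ R) \<and> separated k L R"
      using sv sorts_above_insert_max[of L R ?m k] nm(2)[OF LR] by (auto simp: v perms_iff)
    then have "(L @ R, length L) \<in> ?P"
      using LR by (auto simp: sorting_perms_def active_sites_def)
    moreover have "v = ?ins (L @ R, length L)"
      by (simp add: v insert_at_def)
    ultimately show "v \<in> ?ins ` ?P" by blast
  qed
  ultimately show ?thesis
    by (simp add: bij_betw_def)
qed

text \<open>Descendants \<open>t\<close> levels below the nodes on level \<open>n + 1\<close> are descendants \<open>t + 1\<close> levels below
  their parents. Iterating this moves the whole count to the roots, where the labels are known.\<close>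

lemma tree_level_sum_Suc:
  "(\<Sum>v\<in>sorting_perms (Suc n) k. tree_level t (card (active_sites k v)))
     = (\<Sum>w\<in>sorting_perms n k. tree_level (Suc t) (card (active_sites k w)))"
proof -
  let ?m = "Suc (n + k)"
  have "(\<Sum>v\<in>sorting_perms (Suc n) k. tree_level t (card (active_sites k v)))
      = (\<Sum>(w, i)\<in>(SIGMA w:sorting_perms n k. active_sites k w).
           tree_level t (card (active_sites k (insert_at i ?m w))))"
    by (subst sum.reindex_bij_betw[OF insert_max_bij, symmetric]) (simp add: case_prod_beta)
  also have "\<dots> = (\<Sum>w\<in>sorting_perms n k. \<Sum>i\<in>active_sites k w.
           tree_level t (card (active_sites k (insert_at i ?m w))))"
    by (subst sum.Sigma) auto
  also have "\<dots> = (\<Sum>w\<in>sorting_perms n k. \<Sum>i\<in>active_sites k w.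
           tree_level t (Suc (card {j \<in> active_sites k w. j \<le> i})))"
  proof (intro sum.cong refl)
    fix w i assume "w \<in> sorting_perms n k" "i \<in> active_sites k w"
    then show "tree_level t (card (active_sites k (insert_at i ?m w)))
             = tree_level t (Suc (card {j \<in> active_sites k w. j \<le> i}))"
      by (subst card_active_sites_insert_at)
        (auto simp: sorting_perms_def active_sites_def perms_iff)
  qed
  also have "\<dots> = (\<Sum>w\<in>sorting_perms n k. tree_level (Suc t) (card (active_sites k w)))"
    by (simp add: sum_over_ranks[where f = "\<lambda>c. tree_level t (Suc c)"])
  finally show ?thesis .
qed

lemma tree_level_sum_shift:
  "(\<Sum>w\<in>sorting_perms n k. tree_level t (card (active_sites k w)))
     = (\<Sum>w\<in>sorting_perms 0 k. tree_level (n + t) (card (active_sites k w)))"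
proof (induction n arbitrary: t)
  case (Suc n)
  show ?case
    unfolding tree_level_sum_Suc Suc.IH by simp
qed simp

lemma card_sorting_perms: "card (sorting_perms n k) = fact k * tree_level n (Suc k)"
proof -
  have all: "sorting_perms 0 k = perms k"
    by (auto simp: sorting_perms_def sorts_above_def set_stack_sort perms_iff
        intro!: ascends_above_low)
  have "active_sites k w = {..k}" if "w \<in> perms k" for w
    using that length_perms[OF that]
    by (fastforce simp: active_sites_def separated_def perms_iff dest: in_set_takeD)
  then have sites: "(\<Sum>w\<in>perms k. tree_level n (card (active_sites k w))) = fact k * tree_level n (Suc k)"
    by (simp add: perms_def)
  have "card (sorting_perms n k)
      = (\<Sum>w\<in>sorting_perms n k. tree_level 0 (card (active_sites k w)))"
    by simp
  also have "\<dots> = (\<Sum>w\<in>perms k. tree_level n (card (active_sites k w)))"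
    using tree_level_sum_shift[where n = n and k = k and t = 0] by (simp only: all add_0_right)
  finally show ?thesis
    using sites by simp
qed

section \<open>Levels of the tree as Catalan convolutions\<close>

text \<open>The ballot number \<open>tree_level n m = (2n + m - 1 choose n) - (2n + m - 1 choose n - 1)\<close> for
  \<open>n > 0\<close>, stated without subtraction. The last summand in the definition gives
  \<open>tree_level (n + 1) (m + 1) = tree_level (n + 1) m + tree_level n (m + 2)\<close>, and Pascal's rule gives
  the same for the binomial coefficients.\<close>

lemma tree_level_ballot:
  "tree_level (Suc n) m + ((2 * n + m + 1) choose n) = (2 * n + m + 1) choose Suc n"
proof (induction n arbitrary: m)
  case 0
  then show ?case by simp
next
  case outer: (Suc n)
  show ?case
  proof (induction m)
    case 0
    show ?case
      using binomial_symmetric[of "Suc n" "2 * Suc n + 1"] by simp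
  next
    case (Suc m)
    have "tree_level (Suc (Suc n)) (Suc m)
        = tree_level (Suc (Suc n)) m + tree_level (Suc n) (m + 2)"
      by (simp only: tree_level.simps(2) sum.lessThan_Suc)
    with Suc.IH outer.IH[of "m + 2"] show ?case
      by simp
  qed
qed

lemma tree_level_1: "tree_level n 1 = catalan n"
proof (cases n)
  case 0
  then show ?thesis by (simp add: catalan_def)
next
  case (Suc p)
  define b c where "b = (2 * n) choose n" and "c = (2 * n) choose p"
  have "tree_level n 1 + c = b"
    using tree_level_ballot[of p 1] by (simp add: b_def c_def Suc)
  moreover have "Suc n * c = n * b"
    using binomial_absorb_comp[of "2 * n" p] binomial_absorption[of p "2 * n"]
    unfolding b_def c_def by (simp add: Suc)
  ultimately have "Suc n * tree_level n 1 = b"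
    by (metis add_diff_cancel_right' diff_add_inverse2 diff_mult_distrib2 mult_Suc)
  then have "tree_level n 1 = b div Suc n"
    by (metis nonzero_mult_div_cancel_left nat.distinct(1))
  then show ?thesis
    by (simp add: catalan_def b_def)
qed

definition tree_fps :: "nat \<Rightarrow> int fps" where
  "tree_fps m = Abs_fps (\<lambda>n. int (tree_level n m))"

lemma tree_fps_0: "tree_fps 0 = 1"
proof (rule fps_ext)
  fix n show "fps_nth (tree_fps 0) n = fps_nth 1 n"
    by (cases n) (simp_all add: tree_fps_def)
qed

lemma tree_fps_Suc: "tree_fps (Suc m) = tree_fps m + fps_X * tree_fps (m + 2)"
proof (rule fps_ext)
  fix n show "fps_nth (tree_fps (Suc m)) n = fps_nth (tree_fps m + fps_X * tree_fps (m + 2)) n"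
    by (cases n) (simp_all add: tree_fps_def)
qed

text \<open>As functions of \<open>a\<close>, both sides solve \<open>G (a + 1) = G a + x G (a + 2)\<close> with the same value at
  \<open>a = 0\<close>. This determines them: the factor \<open>x\<close> lowers the index of the coefficient, which pays for
  the larger argument \<open>a + 2\<close>. Hence an outer induction on \<open>n\<close>, for all \<open>a\<close>, and an inner one on \<open>a\<close>.\<close>

lemma tree_fps_add: "tree_fps (a + b) = tree_fps a * tree_fps b"
proof (rule fps_ext)
  fix n show "fps_nth (tree_fps (a + b)) n = fps_nth (tree_fps a * tree_fps b) n"
  proof (induction n arbitrary: a rule: less_induct)
    case (less n)
    show ?case
    proof (induction a)
      case 0
      show ?case by (simp add: tree_fps_0)
    next
      case (Suc a)
      have "fps_nth (fps_X * tree_fps (a + b + 2)) n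
          = fps_nth (fps_X * (tree_fps (a + 2) * tree_fps b)) n"
        using less.IH[of "n - 1" "a + 2"] by (auto simp: add_ac)
      moreover have "tree_fps (Suc a + b) = tree_fps (a + b) + fps_X * tree_fps (a + b + 2)"
        using tree_fps_Suc[of "a + b"] by (simp only: add_Suc)
      moreover have "tree_fps (Suc a) * tree_fps b
          = tree_fps a * tree_fps b + fps_X * (tree_fps (a + 2) * tree_fps b)"
        by (simp only: tree_fps_Suc[of a] distrib_right mult.assoc)
      ultimately show ?case
        using Suc by (simp only: fps_add_nth)
    qed
  qed
qed

lemma tree_fps_power: "tree_fps m = tree_fps 1 ^ m"
proof (induction m)
  case (Suc m)
  then show ?case
    using tree_fps_add[of 1 m] by simp
qed (simp add: tree_fps_0)

lemma catalan_conv_eq_tree_level: "catalan_conv n k = tree_level n (Suc k)"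
proof -
  have "int (tree_level n (Suc k)) = fps_nth (tree_fps 1 ^ Suc k) n"
    by (simp only: tree_fps_power[symmetric]) (simp add: tree_fps_def)
  also have "\<dots> = (\<Sum>v\<in>natpermute n (Suc k). \<Prod>j=0..k. fps_nth (tree_fps 1) (v ! j))"
    using fps_power_nth_Suc[of "tree_fps 1" k n] by simp
  also have "\<dots> = (\<Sum>v\<in>natpermute n (Suc k). int (prod_list (map catalan v)))"
  proof (rule sum.cong)
    fix v assume "v \<in> natpermute n (Suc k)"
    then have "{0..k} = {0..<length v}"
      by (auto simp: natpermute_def)
    then show "(\<Prod>j=0..k. fps_nth (tree_fps 1) (v ! j)) = int (prod_list (map catalan v))"
      using tree_level_1 by (simp add: prod.list_conv_set_nth tree_fps_def)
  qed simp
  finally show ?thesis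
    by (simp add: catalan_conv_def natpermute_def flip: of_nat_sum)
qed

theorem corollary3p3:
  fixes n k :: nat
  shows "card {w \<in> perms (n + k). stack_sort w \<in> perms_fix_above n k} = fact k * catalan_conv n k"
proof -
  have "{w \<in> perms (n + k). stack_sort w \<in> perms_fix_above n k} = sorting_perms n k"
    using fixes_above_iff_ascends_above stack_sort_in_perms
    by (auto simp: sorting_perms_def sorts_above_def)
  then show ?thesis
    by (simp add: card_sorting_perms catalan_conv_eq_tree_level)
qed

end
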